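(* For every positive integer $n$, $$\xi_{n,q}(2)=1+\frac{1}{q}+\frac{1}{q^2}\,\xi_{n,q}.$$
   Context: Let $p$ be an odd prime, $\mathbb{C}_p$ the completion of an algebraic closure of $\mathbb{Q}_p$, and $q\in\mathbb{C}_p$ with $|1-q|_p<1$ (so $q^x$ is defined for $x\in\mathbb{Z}_p$). Put $[x]_q=\frac{1-q^x}{1-q}$. The $q$-Euler numbers $\xi_{n,q}$ are defined by $\xi_{0,q}=1$ and, for $n\ge 1$, $q\sum_{l=0}^{n}\binom{n}{l}q^l\xi_{l,q}+\xi_{n,q}=0$ (i.e. $q(q\xi+1)^n+\xi_{n,q}=0$ with the umbral convention $\xi^l\mapsto\xi_{l,q}$). The $q$-Euler polynomials are $\xi_{n,q}(x)=\sum_{l=0}^{n}\binom{n}{l}[x]_q^{\,n-l}q^{lx}\xi_{l,q}$ for $n\ge0$. *)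

theory Defs
  imports "HOL-Analysis.Analysis" "HOL-Computational_Algebra.Polynomial" "HOL-Computational_Algebra.Primes"
begin

definition padic_abs_rat :: "nat \<Rightarrow> rat \<Rightarrow> real" where
  "padic_abs_rat p r =
     (if r = 0 then 0
      else real p powi (int (multiplicity (int p) (snd (quotient_of r)))
                      - int (multiplicity (int p) (fst (quotient_of r)))))"

definition is_subfield :: "'a::field set \<Rightarrow> bool" where
  "is_subfield S \<longleftrightarrow>
     0 \<in> S \<and> 1 \<in> S \<and> (\<forall>x\<in>S. \<forall>y\<in>S. x - y \<in> S \<and> x * y \<in> S) \<and> (\<forall>x\<in>S. inverse x \<in> S)"

definition algebraic_over_set :: "'a::field set \<Rightarrow> 'a \<Rightarrow> bool" where
  "algebraic_over_set F x \<longleftrightarrow> (\<exists>P. P \<noteq> 0 \<and> (\<forall>i. coeff P i \<in> F) \<and> poly P x = 0)"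

definition is_algebraic_closure_of :: "'a::field set \<Rightarrow> 'a set \<Rightarrow> bool" where
  "is_algebraic_closure_of A F \<longleftrightarrow>
     is_subfield F \<and> is_subfield A \<and> F \<subseteq> A \<and>
     (\<forall>x\<in>A. algebraic_over_set F x) \<and>
     (\<forall>P. (\<forall>i. coeff P i \<in> A) \<and> degree P > 0 \<longrightarrow> (\<exists>x\<in>A. poly P x = 0))"

text \<open>
  The field \<open>'a\<close>, complete for the metric of a non-archimedean absolute value \<open>v\<close> extending the
  \<open>p\<close>-adic one on the rationals, is a model of \<open>\<complex>\<^sub>p\<close>. Inside it \<open>\<rat>\<^sub>p\<close>, the completion of the
  rationals, is the topological closure of the prime field; \<open>'a\<close> is the completion of an
  algebraic closure \<open>A\<close> of \<open>\<rat>\<^sub>p\<close>, that is, it is complete and \<open>A\<close> is dense in it. These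
  conditions determine \<open>('a, v)\<close> up to isometric isomorphism.
\<close>

locale padic_complex_field =
  fixes p :: nat and v :: "'a::{field_char_0, complete_space} \<Rightarrow> real"
  assumes prime_p: "prime p"
    and dist_v: "dist x y = v (x - y)"
    and v_mult: "v (x * y) = v x * v y"
    and v_ultrametric: "v (x + y) \<le> max (v x) (v y)"
    and v_of_rat: "v (of_rat r) = padic_abs_rat p r"
    and completion_of_algebraic_closure:
      "\<exists>A :: 'a set. is_algebraic_closure_of A (closure (range of_rat)) \<and> closure A = UNIV"

text \<open>
  For \<open>|1 - q| < 1\<close> and \<open>x\<close> in \<open>\<int>\<^sub>p\<close> (embedded in \<open>'a\<close>), \<open>q\<^sup>x\<close> is the binomial series
  of \<open>(1 + (q - 1))\<^sup>x\<close>.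
\<close>

definition qpow :: "'a::{field_char_0, complete_space} \<Rightarrow> 'a \<Rightarrow> 'a" where
  "qpow q x = (\<Sum>n. (x gchoose n) * (q - 1) ^ n)"

text \<open>At \<open>q = 1\<close>, where the quotient is not defined, \<open>[x]\<^sub>q\<close> takes its limiting value \<open>x\<close>.\<close>

definition qbracket :: "'a::{field_char_0, complete_space} \<Rightarrow> 'a \<Rightarrow> 'a" where
  "qbracket q x = (if q = 1 then x else (1 - qpow q x) / (1 - q))"

text \<open>
  The relation for \<open>n \<ge> 1\<close> has a unique solution when all \<open>1 + q ^ (n + 1)\<close> are nonzero, which
  holds for \<open>|1 - q| < 1\<close> and \<open>p\<close> odd.
\<close>

definition is_q_Euler_numbers :: "'a::field \<Rightarrow> (nat \<Rightarrow> 'a) \<Rightarrow> bool" where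
  "is_q_Euler_numbers q \<xi> \<longleftrightarrow>
     \<xi> 0 = 1 \<and>
     (\<forall>n\<ge>1. q * (\<Sum>l=0..n. of_nat (n choose l) * q ^ l * \<xi> l) + \<xi> n = 0)"

definition q_Euler_number :: "'a::field \<Rightarrow> nat \<Rightarrow> 'a" where
  "q_Euler_number q = (THE \<xi>. is_q_Euler_numbers q \<xi>)"

definition q_Euler_poly :: "'a::{field_char_0, complete_space} \<Rightarrow> nat \<Rightarrow> 'a \<Rightarrow> 'a" where
  "q_Euler_poly q n x =
     (\<Sum>l=0..n. of_nat (n choose l) * qbracket q x ^ (n - l) * qpow q (of_nat l * x)
               * q_Euler_number q l)"

end

theory Submission imports Defs begin

text \<open>
  In umbral notation \<open>\<xi>\<^sub>n(2) = (1 + q + q\<^sup>2\<xi>)\<^sup>n = (1 + q(1 + q\<xi>))\<^sup>n\<close>. Expanding in powers of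
  \<open>1 + q\<xi>\<close> and applying the recurrence \<open>q(1 + q\<xi>)\<^sup>l = -\<xi>\<^sub>l\<close> to the terms with \<open>l \<ge> 1\<close> leaves
  \<open>1 - ((1 + q\<xi>)\<^sup>n - 1) / q\<close>, and a second application of the recurrence gives the claim.
  The recurrence has a unique solution because \<open>q\<^sup>k = -1\<close> would give
  \<open>|2| = |1 - q\<^sup>k| < 1\<close>, which fails for odd \<open>p\<close>.
\<close>

text \<open>At a natural exponent the binomial series stops, since \<open>m choose k\<close>
  vanishes for \<open>k > m\<close>; what remains is the expansion of
  \<open>((q - 1) + 1) ^ m\<close>.\<close>

lemma qpow_of_nat: "qpow q (of_nat m) = q ^ m"
proof -
  have "qpow q (of_nat m) = (\<Sum>k\<le>m. (of_nat m gchoose k) * (q - 1) ^ k)"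
    unfolding qpow_def
    by (rule suminf_finite) (auto simp: binomial_gbinomial[symmetric] not_le)
  also have "\<dots> = (\<Sum>k\<le>m. of_nat (m choose k) * (q - 1) ^ k * 1 ^ (m - k))"
    by (simp add: binomial_gbinomial)
  also have "\<dots> = ((q - 1) + 1) ^ m"
    by (simp only: binomial_ring)
  finally show ?thesis by simp
qed

text \<open>For \<open>q \<noteq> 1\<close> this is \<open>(1 - q\<^sup>2) / (1 - q)\<close>; at
  \<open>q = 1\<close> the limiting value 2 agrees with it.\<close>

lemma qbracket_2: "qbracket q 2 = 1 + q"
proof (cases "q = 1")
  case False
  moreover have "qpow q 2 = q ^ 2"
    using qpow_of_nat[of q 2] by simp
  ultimately show ?thesis
    by (simp add: qbracket_def field_simps power2_eq_square)
qed (simp add: qbracket_def)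

text \<open>Umbrally this is \<open>(1 + a(1 + bx))^n = ((1 + a) + abx)^n\<close>. Exchanging the
  sums and using \<open>choose_mult\<close> isolates, for each \<open>j\<close>, a binomial
  expansion of \<open>(1 + a) ^ (n - j)\<close>.\<close>

lemma binomial_sum_nested:
  fixes a b :: "'a::comm_semiring_1" and x :: "nat \<Rightarrow> 'a"
  shows "(\<Sum>l=0..n. of_nat (n choose l) * a ^ l * (\<Sum>j=0..l. of_nat (l choose j) * b ^ j * x j))
       = (\<Sum>j=0..n. of_nat (n choose j) * (1 + a) ^ (n - j) * (a * b) ^ j * x j)"
proof -
  have inner: "(\<Sum>l=j..n. of_nat (n choose l) * a ^ l * (of_nat (l choose j) * b ^ j * x j))
      = of_nat (n choose j) * (1 + a) ^ (n - j) * (a * b) ^ j * x j" if "j \<le> n" for j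
  proof -
    have "(\<Sum>l=j..n. of_nat (n choose l) * a ^ l * (of_nat (l choose j) * b ^ j * x j))
        = (\<Sum>l=j..n. of_nat (n choose j) * (a * b) ^ j * x j
              * (of_nat ((n - j) choose (l - j)) * a ^ (l - j)))"
    proof (rule sum.cong)
      fix l assume l: "l \<in> {j..n}"
      have "of_nat (n choose l) * of_nat (l choose j)
          = (of_nat (n choose j) * of_nat ((n - j) choose (l - j)) :: 'a)"
        using choose_mult[of j l n] l by (simp flip: of_nat_mult)
      moreover have "a ^ l = a ^ j * a ^ (l - j)"
        using l by (simp flip: power_add)
      moreover have "of_nat (n choose l) * a ^ l * (of_nat (l choose j) * b ^ j * x j)
          = (of_nat (n choose l) * of_nat (l choose j)) * a ^ l * (b ^ j * x j)"
        by (simp only: ac_simps)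
      ultimately show "of_nat (n choose l) * a ^ l * (of_nat (l choose j) * b ^ j * x j)
          = of_nat (n choose j) * (a * b) ^ j * x j
              * (of_nat ((n - j) choose (l - j)) * a ^ (l - j))"
        by (simp only: power_mult_distrib ac_simps)
    qed simp
    also have "\<dots> = of_nat (n choose j) * (a * b) ^ j * x j
        * (\<Sum>l=j..n. of_nat ((n - j) choose (l - j)) * a ^ (l - j))"
      by (simp add: sum_distrib_left)
    also have "(\<Sum>l=j..n. of_nat ((n - j) choose (l - j)) * a ^ (l - j))
        = (\<Sum>k\<le>n - j. of_nat ((n - j) choose k) * a ^ k * 1 ^ (n - j - k))"
      using that by (intro sum.reindex_bij_witness[of _ "\<lambda>k. k + j" "\<lambda>l. l - j"]) auto
    also have "\<dots> = (1 + a) ^ (n - j)"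
      by (simp only: binomial_ring[symmetric] add.commute)
    finally show ?thesis by (simp add: ac_simps)
  qed
  have "(\<Sum>l=0..n. of_nat (n choose l) * a ^ l * (\<Sum>j=0..l. of_nat (l choose j) * b ^ j * x j))
      = (\<Sum>l=0..n. \<Sum>j=0..l. of_nat (n choose l) * a ^ l * (of_nat (l choose j) * b ^ j * x j))"
    by (simp add: sum_distrib_left)
  also have "\<dots> = (\<Sum>j=0..n. \<Sum>l=j..n.
      of_nat (n choose l) * a ^ l * (of_nat (l choose j) * b ^ j * x j))"
    \<comment> \<open>Both double sums run over the triangle \<open>j \<le> l \<le> n\<close>; the
      bijection swaps the coordinates.\<close>
    unfolding sum.Sigma[OF finite_atLeastAtMost ballI[OF finite_atLeastAtMost]]
    by (rule sum.reindex_bij_witness[of _ "\<lambda>(j, l). (l, j)" "\<lambda>(l, j). (j, l)"]) auto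
  also have "\<dots> = (\<Sum>j=0..n. of_nat (n choose j) * (1 + a) ^ (n - j) * (a * b) ^ j * x j)"
    using inner by (intro sum.cong) auto
  finally show ?thesis .
qed

text \<open>The defining relation solved for its top term: the summand \<open>l = n\<close>
  contributes \<open>q ^ (n + 1) * \<xi> n\<close>, whence the denominator.\<close>

fun q_Euler_rec :: "'a::field \<Rightarrow> nat \<Rightarrow> 'a" where
  "q_Euler_rec q n =
     (if n = 0 then 1
      else - q * (\<Sum>l<n. of_nat (n choose l) * q ^ l * q_Euler_rec q l) / (1 + q ^ (n + 1)))"

declare q_Euler_rec.simps [simp del]

text \<open>The description by \<open>THE\<close> is meaningful because nonzero denominators turn
  the relation into a recursion: \<open>q_Euler_rec\<close> solves it, and strong induction shows
  that every solution equals it.\<close>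

lemma is_q_Euler_numbers_q_Euler_number:
  fixes q :: "'a::field"
  assumes nz: "\<And>k. 1 + q ^ k \<noteq> 0"
  shows "is_q_Euler_numbers q (q_Euler_number q)"
proof -
  have split: "q * (\<Sum>l=0..n. of_nat (n choose l) * q ^ l * \<xi> l) + \<xi> n
      = q * (\<Sum>l<n. of_nat (n choose l) * q ^ l * \<xi> l) + (1 + q ^ (n + 1)) * \<xi> n"
    for n and \<xi> :: "nat \<Rightarrow> 'a"
    by (simp add: atLeast0AtMost lessThan_Suc_atMost[symmetric] algebra_simps)
  have iff: "is_q_Euler_numbers q \<xi> \<longleftrightarrow> \<xi> 0 = 1 \<and>
      (\<forall>n\<ge>1. \<xi> n = - q * (\<Sum>l<n. of_nat (n choose l) * q ^ l * \<xi> l) / (1 + q ^ (n + 1)))"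
    for \<xi>
  proof -
    have *: "s + c * y = 0 \<longleftrightarrow> y = - s / c" if "c \<noteq> 0" for s c y :: 'a
      using that by (auto simp: eq_divide_eq add_eq_0_iff2 ac_simps)
    show ?thesis
      unfolding is_q_Euler_numbers_def split *[OF nz] by simp
  qed
  have "is_q_Euler_numbers q (q_Euler_rec q)"
    unfolding iff
  proof (intro conjI allI impI)
    show "q_Euler_rec q 0 = 1" by (subst q_Euler_rec.simps) simp
  next
    fix n :: nat assume "n \<ge> 1"
    then show "q_Euler_rec q n
        = - q * (\<Sum>l<n. of_nat (n choose l) * q ^ l * q_Euler_rec q l) / (1 + q ^ (n + 1))"
      by (subst q_Euler_rec.simps) simp
  qed
  moreover have "\<xi> = q_Euler_rec q" if "is_q_Euler_numbers q \<xi>" for \<xi>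
  proof
    fix n
    show "\<xi> n = q_Euler_rec q n"
    proof (induction n rule: less_induct)
      case (less n)
      then show ?case
        using that unfolding iff by (subst q_Euler_rec.simps) auto
    qed
  qed
  ultimately show ?thesis
    unfolding q_Euler_number_def by (rule theI)
qed

context padic_complex_field
begin

text \<open>In lowest terms the integer is \<open>k / 1\<close>, and \<open>p\<close> divides
  neither part, so the exponent of \<open>p\<close> is 0.\<close>

lemma v_of_int_eq_1:
  assumes "\<not> int p dvd k"
  shows "v (of_int k) = 1"
proof -
  have "k \<noteq> 0" using assms by auto
  moreover have "quotient_of (of_int k) = (k, 1)"
    by (metis quotient_of_int Rat.of_int_def)
  ultimately have "padic_abs_rat p (of_int k) = 1"
    using assms by (simp add: padic_abs_rat_def not_dvd_imp_multiplicity_0)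
  then show ?thesis
    using v_of_rat[of "of_int k"] by simp
qed

lemma v_1: "v 1 = 1"
  using v_of_int_eq_1[of 1] prime_p by (auto simp: prime_nat_iff)

lemma v_nonneg: "0 \<le> v x"
  using dist_v[of x 0] by (metis diff_zero zero_le_dist)

lemma v_le_1_if_v_one_minus_less_1:
  assumes "v (1 - q) < 1"
  shows "v q \<le> 1"
proof -
  have "v (q - 1) = v (1 - q)"
    by (metis dist_commute dist_v)
  then show ?thesis
    using v_ultrametric[of 1 "q - 1"] v_1 assms by simp
qed

text \<open>Induction through \<open>1 - q ^ Suc k = (1 - q) + q * (1 - q ^ k)\<close>: since
  \<open>v q \<le> 1\<close>, both summands lie in the open unit ball, which the ultrametric
  inequality closes under addition.\<close>

lemma v_one_minus_power_less_1:
  assumes "v (1 - q) < 1"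
  shows "v (1 - q ^ k) < 1"
proof (induction k)
  case 0
  show ?case using dist_v[of 1 1] by simp
next
  case (Suc k)
  have "v (q * (1 - q ^ k)) < 1"
    using Suc v_le_1_if_v_one_minus_less_1[OF assms] v_nonneg[of q] v_nonneg[of "1 - q ^ k"]
      mult_left_le_one_le[of "v (1 - q ^ k)" "v q"]
    by (simp add: v_mult)
  moreover have "1 - q ^ Suc k = (1 - q) + q * (1 - q ^ k)"
    by (simp add: algebra_simps)
  ultimately show ?case
    using v_ultrametric[of "1 - q" "q * (1 - q ^ k)"] assms
    by (metis max_less_iff_conj order.strict_trans1)
qed

lemma one_plus_power_nonzero:
  assumes "odd p" and "v (1 - q) < 1"
  shows "1 + q ^ k \<noteq> 0"
proof
  assume "1 + q ^ k = 0"
  then have "1 - q ^ k = of_int 2"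
    by (simp add: add_eq_0_iff)
  moreover have "\<not> int p dvd 2"
  proof
    assume "int p dvd 2"
    then have "p dvd 2" by presburger
    then show False
      using prime_p assms(1) two_is_prime_nat by (metis primes_dvd_imp_eq)
  qed
  ultimately show False
    using v_one_minus_power_less_1[OF assms(2), of k] v_of_int_eq_1[of 2] by (metis less_irrefl)
qed

end

theorem theorem1:
  fixes p n :: nat and v :: "'a::{field_char_0, complete_space} \<Rightarrow> real" and q :: 'a
  assumes "padic_complex_field p v" and "odd p"
    and "v (1 - q) < 1"
    and "n > 0"
  shows "q_Euler_poly q n 2 = 1 + 1 / q + 1 / q ^ 2 * q_Euler_number q n"
proof -
  interpret padic_complex_field p v by fact
  \<comment> \<open>For \<open>q = 0\<close> the assumption would read
    \<open>v 1 < 1\<close>.\<close>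
  have "q \<noteq> 0" using assms(3) v_1 by auto
  define \<xi> where "\<xi> = q_Euler_number q"
  define S where "S m = (\<Sum>l=0..m. of_nat (m choose l) * q ^ l * \<xi> l)" for m
  have "is_q_Euler_numbers q \<xi>"
    unfolding \<xi>_def
    using one_plus_power_nonzero[OF assms(2,3)] by (rule is_q_Euler_numbers_q_Euler_number)
  then have \<xi>0: "\<xi> 0 = 1" and rec: "\<And>m. m \<ge> 1 \<Longrightarrow> q * S m + \<xi> m = 0"
    by (auto simp: is_q_Euler_numbers_def S_def)
  have S: "S m = - \<xi> m / q" if "m \<ge> 1" for m
  proof -
    have "S m * q = - \<xi> m"
      using rec[OF that] by (simp add: add_eq_0_iff2 mult.commute)
    then show ?thesis
      using \<open>q \<noteq> 0\<close> by (metis nonzero_eq_divide_eq)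
  qed
  have qpow_double: "qpow q (of_nat l * 2) = (q * q) ^ l" for l
    using qpow_of_nat[of q "l * 2"] by (simp add: power_mult power_mult_distrib power2_eq_square)
  have "q_Euler_poly q n 2 = (\<Sum>l=0..n. of_nat (n choose l) * q ^ l * S l)"
    \<comment> \<open>The nested identity with \<open>a = b = q\<close>: here \<open>1 + a\<close>
      is \<open>[2]_q\<close> and \<open>(a * b) ^ l\<close> is \<open>q ^ (2 * l)\<close>.\<close>
    unfolding q_Euler_poly_def S_def binomial_sum_nested qbracket_2 qpow_double \<xi>_def ..
  \<comment> \<open>The term \<open>l = 0\<close> is split off because the recurrence starts at
    index 1; its value is \<open>S 0 = \<xi> 0 = 1\<close>.\<close>
  also have "\<dots> = 1 + (\<Sum>l=Suc 0..n. of_nat (n choose l) * q ^ l * S l)"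
    by (simp add: sum.atLeast_Suc_atMost S_def \<xi>0)
  also have "(\<Sum>l=Suc 0..n. of_nat (n choose l) * q ^ l * S l)
      = - (\<Sum>l=Suc 0..n. of_nat (n choose l) * q ^ l * \<xi> l) / q"
    by (simp add: S sum_divide_distrib sum_negf)
  \<comment> \<open>The remaining sum is \<open>S n\<close> without its initial term 1, so the
    recurrence applies again, now at \<open>n > 0\<close>.\<close>
  also have "(\<Sum>l=Suc 0..n. of_nat (n choose l) * q ^ l * \<xi> l) = S n - 1"
    by (simp add: sum.atLeast_Suc_atMost S_def \<xi>0)
  also have "S n = - \<xi> n / q"
    using S assms(4) by simp
  finally show ?thesis
    using \<open>q \<noteq> 0\<close> by (simp add: \<xi>_def field_simps power2_eq_square)
qed

end
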